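(* Let $\mu\ge 0$ and let $K_n^\mu$ ($n\ge 1$) be the operators $$K_n^\mu(f;x)=\frac{1}{Q(1)\,e_\mu(nx)}\sum_{i=0}^\infty \frac{q_i(nx)}{\gamma_\mu(i)}\, f\!\left(\frac{i+2\mu\theta_i}{n}\right),\qquad x\in[0,\infty),$$ built from a Dunkl-Appell polynomial set $(q_i)$ with generating function $Q(t)e_\mu(xt)$ as described in the context. Let $f:[0,\infty)\to\mathbb{R}$ be continuous and suppose that there is $A\in\mathbb{R}$ with $$\frac{f(x)}{1+x^2}\to A\quad (x\to\infty).$$ Then for every $0\le a<b<\infty$ the sequence $\{K_n^\mu(f;\cdot)\}_{n\ge1}$ converges uniformly to $f$ on $[a,b]$.
   Context: Let $\mu\ge 0$. Put $\theta_i=0$ for even $i$ and $\theta_i=1$ for odd $i$ ($i\in\mathbb{N}_0$). Define $$\gamma_\mu(2i)=\frac{2^{2i}\,i!\,\Gamma(i+\mu+1/2)}{\Gamma(\mu+1/2)},\qquad \gamma_\mu(2i+1)=\frac{2^{2i+1}\,i!\,\Gamma(i+\mu+3/2)}{\Gamma(\mu+1/2)},$$ so that $\gamma_\mu(i+1)=(i+1+2\mu\theta_{i+1})\gamma_\mu(i)$, and $e_\mu(x)=\sum_{i=0}^\infty x^i/\gamma_\mu(i)$. Let $Q(t)=\sum_{i=0}^\infty \frac{a_i}{\gamma_\mu(i)}t^i$ with real coefficients $a_i$, $a_0\ne0$, be analytic in a disc $|t|<R$ with $R>1$, and suppose $Q(1)\neq0$. The associated Dunkl-Appell polynomials $q_i$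 are defined by $Q(t)e_\mu(xt)=\sum_{i=0}^\infty \frac{q_i(x)}{\gamma_\mu(i)}t^i$; equivalently $q_i(x)=\sum_{j=0}^i \frac{\gamma_\mu(i)}{\gamma_\mu(j)\gamma_\mu(i-j)}a_{i-j}x^j$. It is assumed that $q_i(x)\ge0$ for all $x\in[0,\infty)$ and all $i$, so that the operators $K_n^\mu$ are positive. *)

theory Defs
  imports "HOL-Analysis.Analysis"
begin

definition dunkl_theta :: "nat \<Rightarrow> real" where
  "dunkl_theta i = (if even i then 0 else 1)"

definition dunkl_gamma :: "real \<Rightarrow> nat \<Rightarrow> real" where
  "dunkl_gamma \<mu> n =
     (if even n
      then 2 ^ n * fact (n div 2) * Gamma (real (n div 2) + \<mu> + 1/2) / Gamma (\<mu> + 1/2)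
      else 2 ^ n * fact (n div 2) * Gamma (real (n div 2) + \<mu> + 3/2) / Gamma (\<mu> + 1/2))"

definition dunkl_exp :: "real \<Rightarrow> real \<Rightarrow> real" where
  "dunkl_exp \<mu> x = (\<Sum>i. x ^ i / dunkl_gamma \<mu> i)"

text \<open>
  The function \<open>Q\<close> with coefficient sequence \<open>a\<close>. It is polymorphic so that the same definition
  gives the function on the complex disc, where analyticity is required, and the real value
  \<open>Q(1)\<close> used in the operators.
\<close>

definition dunkl_Q ::
  "real \<Rightarrow> (nat \<Rightarrow> real) \<Rightarrow> 'a::{real_normed_field, banach} \<Rightarrow> 'a" where
  "dunkl_Q \<mu> a t = (\<Sum>i. of_real (a i / dunkl_gamma \<mu> i) * t ^ i)"

text \<open>
  The Dunkl-Appell polynomials, by their explicit coefficients; the lemma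
  \<open>dunkl_appell_generating\<close> below recovers the generating function.
\<close>

definition dunkl_appell :: "real \<Rightarrow> (nat \<Rightarrow> real) \<Rightarrow> nat \<Rightarrow> real \<Rightarrow> real" where
  "dunkl_appell \<mu> a i x =
     (\<Sum>j\<le>i. dunkl_gamma \<mu> i / (dunkl_gamma \<mu> j * dunkl_gamma \<mu> (i - j)) * a (i - j) * x ^ j)"

definition dunkl_op ::
  "real \<Rightarrow> (nat \<Rightarrow> real) \<Rightarrow> nat \<Rightarrow> (real \<Rightarrow> real) \<Rightarrow> real \<Rightarrow> real" where
  "dunkl_op \<mu> a n f x =
     1 / (dunkl_Q \<mu> a 1 * dunkl_exp \<mu> (real n * x)) *
     (\<Sum>i. dunkl_appell \<mu> a i (real n * x) / dunkl_gamma \<mu> i *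
           f ((real i + 2 * \<mu> * dunkl_theta i) / real n))"

lemma dunkl_gamma_0: "\<mu> \<ge> 0 \<Longrightarrow> dunkl_gamma \<mu> 0 = 1"
proof -
  assume "\<mu> \<ge> 0"
  then have "Gamma (\<mu> + 1/2) > 0"
    by (intro Gamma_real_pos) simp
  then show ?thesis
    by (simp add: dunkl_gamma_def)
qed

lemma dunkl_gamma_Suc:
  assumes "\<mu> \<ge> 0"
  shows "dunkl_gamma \<mu> (Suc i) = (real (Suc i) + 2 * \<mu> * dunkl_theta (Suc i)) * dunkl_gamma \<mu> i"
proof (cases "even i")
  case True
  then obtain k where i: "i = 2 * k" by blast
  have "Gamma ((real k + \<mu> + 1/2) + 1) = (real k + \<mu> + 1/2) * Gamma (real k + \<mu> + 1/2)"
    using assms by (intro Gamma_plus1) (auto elim!: nonpos_Ints_cases)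
  then have "Gamma (real k + \<mu> + 3/2) = (real k + \<mu> + 1/2) * Gamma (real k + \<mu> + 1/2)"
    by (simp add: add.assoc)
  note G = this
  have "dunkl_gamma \<mu> (Suc i) =
      2 * 2 ^ (2 * k) * fact k * Gamma (real k + \<mu> + 3/2) / Gamma (\<mu> + 1/2)"
    by (simp add: i dunkl_gamma_def)
  also have "\<dots> = (2 * real k + 1 + 2 * \<mu>) *
      (2 ^ (2 * k) * fact k * Gamma (real k + \<mu> + 1/2) / Gamma (\<mu> + 1/2))"
    unfolding G by (simp add: algebra_simps add_divide_distrib)
  also have "\<dots> = (real (Suc i) + 2 * \<mu> * dunkl_theta (Suc i)) * dunkl_gamma \<mu> i"
    by (simp add: i dunkl_gamma_def dunkl_theta_def)
  finally show ?thesis .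
next
  case False
  then obtain k where i: "i = 2 * k + 1" by (elim oddE)
  have "Suc i = 2 * Suc k" using i by simp
  then show ?thesis
    by (simp add: i dunkl_gamma_def dunkl_theta_def field_simps)
qed

lemma dunkl_gamma_ge_fact:
  assumes "\<mu> \<ge> 0"
  shows "dunkl_gamma \<mu> i \<ge> fact i"
proof (induction i)
  case 0
  then show ?case using assms by (simp add: dunkl_gamma_0)
next
  case (Suc i)
  have "real (Suc i) * fact i \<le>
      (real (Suc i) + 2 * \<mu> * dunkl_theta (Suc i)) * dunkl_gamma \<mu> i"
    using assms Suc by (intro mult_mono) (auto simp: dunkl_theta_def)
  then show ?case using assms by (simp add: dunkl_gamma_Suc)
qed

lemma dunkl_gamma_pos: "\<mu> \<ge> 0 \<Longrightarrow> dunkl_gamma \<mu> i > 0"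
  by (rule less_le_trans[OF _ dunkl_gamma_ge_fact]) auto

lemma dunkl_exp_abs_summable:
  fixes x :: real
  assumes "\<mu> \<ge> 0"
  shows "summable (\<lambda>i. norm (x ^ i / dunkl_gamma \<mu> i))"
proof (rule summable_comparison_test')
  show "summable (\<lambda>i. \<bar>x\<bar> ^ i / fact i)"
    using summable_exp[of "\<bar>x\<bar>"] by (simp add: field_simps)
  fix i :: nat
  show "norm (norm (x ^ i / dunkl_gamma \<mu> i)) \<le> \<bar>x\<bar> ^ i / fact i"
    using dunkl_gamma_ge_fact[OF assms, of i] dunkl_gamma_pos[OF assms, of i]
    by (simp add: power_abs frac_le)
qed

lemma dunkl_appell_generating:
  fixes t x :: real
  assumes mu: "\<mu> \<ge> 0"
    and conv: "\<forall>z::complex. norm z < R \<longrightarrow> summable (\<lambda>i. of_real (a i / dunkl_gamma \<mu> i) * z ^ i)"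
    and t: "\<bar>t\<bar> < R"
  shows "(\<lambda>i. dunkl_appell \<mu> a i x / dunkl_gamma \<mu> i * t ^ i) sums
           (dunkl_Q \<mu> a t * dunkl_exp \<mu> (x * t))"
proof -
  obtain s where s: "\<bar>t\<bar> < s" "s < R" using t dense by blast
  have "summable (\<lambda>i. complex_of_real (a i / dunkl_gamma \<mu> i) * complex_of_real s ^ i)"
    using conv s by auto
  then have "summable (\<lambda>i. complex_of_real (a i / dunkl_gamma \<mu> i * s ^ i))"
    by simp
  then have "summable (\<lambda>i. a i / dunkl_gamma \<mu> i * s ^ i)"
    by (simp only: summable_complex_of_real)
  then have Q: "summable (\<lambda>i. norm (a i / dunkl_gamma \<mu> i * t ^ i))"
    by (rule powser_insidea) (use s in auto)
  have "(\<lambda>k. \<Sum>i\<le>k. (x * t) ^ i / dunkl_gamma \<mu> i * (a (k - i) / dunkl_gamma \<mu> (k - i) * t ^ (k - i)))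
      sums (dunkl_exp \<mu> (x * t) * dunkl_Q \<mu> a t)"
    unfolding dunkl_exp_def dunkl_Q_def of_real_eq_id id_apply
    by (rule Cauchy_product_sums[OF dunkl_exp_abs_summable[OF mu] Q])
  moreover have "(\<Sum>i\<le>k. (x * t) ^ i / dunkl_gamma \<mu> i * (a (k - i) / dunkl_gamma \<mu> (k - i) * t ^ (k - i)))
      = dunkl_appell \<mu> a k x / dunkl_gamma \<mu> k * t ^ k" for k
    unfolding dunkl_appell_def sum_divide_distrib sum_distrib_right
  proof (rule sum.cong[OF refl])
    fix i assume "i \<in> {..k}"
    then have *: "t ^ k = t ^ i * t ^ (k - i)"
      by (simp flip: power_add)
    show "(x * t) ^ i / dunkl_gamma \<mu> i * (a (k - i) / dunkl_gamma \<mu> (k - i) * t ^ (k - i)) =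
      dunkl_gamma \<mu> k / (dunkl_gamma \<mu> i * dunkl_gamma \<mu> (k - i)) * a (k - i) * x ^ i /
        dunkl_gamma \<mu> k * t ^ k"
      unfolding * using dunkl_gamma_pos[OF mu, of k] by (simp add: power_mult_distrib)
  qed
  ultimately show ?thesis by (simp add: mult.commute)
qed

end

theory Submission
  imports Defs
begin

text \<open>
  Only one moment estimate is needed. Put \<open>\<lambda>\<^sub>i = i + 2 \<mu> \<theta>\<^sub>i\<close>. Since \<open>\<gamma>\<^sub>\<mu>(i + 1) = \<lambda>\<^bsub>i+1\<^esub> \<gamma>\<^sub>\<mu>(i)\<close>,
  the series \<open>\<Sum> (\<lambda>\<^sub>i - y)\<^sup>2 y\<^sup>i / \<gamma>\<^sub>\<mu>(i)\<close> is at most \<open>(1 + 2 \<mu>) y e\<^sub>\<mu>(y)\<close>. As \<open>\<lambda>\<^bsub>i+j\<^esub>\<close> differs from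
  \<open>\<lambda>\<^sub>i + \<lambda>\<^sub>j\<close> by at most \<open>4 \<mu>\<close>, a Cauchy product with the coefficients of \<open>Q\<close> (which decay
  geometrically because \<open>R > 1\<close>) shows that the second central moment of \<open>K\<^sub>n\<close> at \<open>x\<close> is
  \<open>O((n x + 1) / n\<^sup>2)\<close>. The growth condition gives \<open>\<bar>f u - f x\<bar> \<le> \<epsilon> + C (u - x)\<^sup>2\<close>
  for all \<open>u \<ge> 0\<close>, uniformly for \<open>x\<close> in a compact set, and positivity of \<open>K\<^sub>n\<close> concludes.
\<close>

section \<open>Nodes and their behaviour under index shifts\<close>

definition dunkl_node :: "real \<Rightarrow> nat \<Rightarrow> real" where
  "dunkl_node \<mu> i = real i + 2 * \<mu> * dunkl_theta i"

lemma dunkl_node_nonneg: "\<mu> \<ge> 0 \<Longrightarrow> dunkl_node \<mu> i \<ge> 0"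
  by (simp add: dunkl_node_def dunkl_theta_def)

lemma dunkl_node_le: "\<mu> \<ge> 0 \<Longrightarrow> dunkl_node \<mu> i \<le> real i + 2 * \<mu>"
  by (simp add: dunkl_node_def dunkl_theta_def)

lemma dunkl_node_Suc_le: "\<mu> \<ge> 0 \<Longrightarrow> dunkl_node \<mu> (Suc i) \<le> dunkl_node \<mu> i + (1 + 2 * \<mu>)"
  by (simp add: dunkl_node_def dunkl_theta_def)

text \<open>Parity is additive except when both indices are odd: then \<open>i + j\<close> is even
  and both corrections \<open>2 * \<mu>\<close> are lost.\<close>

lemma dunkl_node_add:
  "dunkl_node \<mu> (i + j) = dunkl_node \<mu> i + dunkl_node \<mu> j - 4 * \<mu> * dunkl_theta i * dunkl_theta j"
  by (auto simp: dunkl_node_def dunkl_theta_def)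

text \<open>Decouples the two indices of a Cauchy product: one term involves only \<open>i\<close>
  and \<open>y\<close>, the other only \<open>j\<close>. The increment \<open>v\<close> differs from
  \<open>dunkl_node \<mu> j\<close> by 0 or \<open>4 * \<mu>\<close>, and the square of a sum is at
  most twice the sum of the squares.\<close>

lemma dunkl_node_shift_le:
  assumes "\<mu> \<ge> 0"
  shows "(dunkl_node \<mu> (i + j) - y)\<^sup>2 \<le> 2 * (dunkl_node \<mu> i - y)\<^sup>2 + 2 * (dunkl_node \<mu> j + 4 * \<mu>)\<^sup>2"
proof -
  define v where "v = dunkl_node \<mu> j - 4 * \<mu> * dunkl_theta i * dunkl_theta j"
  have "\<bar>v\<bar> \<le> dunkl_node \<mu> j + 4 * \<mu>"
    using assms dunkl_node_nonneg[OF assms, of j] by (auto simp: v_def dunkl_theta_def)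
  then have "v\<^sup>2 \<le> (dunkl_node \<mu> j + 4 * \<mu>)\<^sup>2"
    by (metis abs_ge_zero power2_abs power_mono)
  moreover have "((dunkl_node \<mu> i - y) + v)\<^sup>2 \<le> 2 * (dunkl_node \<mu> i - y)\<^sup>2 + 2 * v\<^sup>2"
    using zero_le_power2[of "(dunkl_node \<mu> i - y) - v"] by (simp add: power2_eq_square algebra_simps)
  moreover have eq: "dunkl_node \<mu> (i + j) - y = (dunkl_node \<mu> i - y) + v"
    by (simp add: dunkl_node_add v_def)
  ultimately show ?thesis unfolding eq by linarith
qed

section \<open>Moments of the weights of the Dunkl exponential\<close>

lemma dunkl_exp_sums: "\<mu> \<ge> 0 \<Longrightarrow> (\<lambda>i. y ^ i / dunkl_gamma \<mu> i) sums dunkl_exp \<mu> y"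
  unfolding dunkl_exp_def by (rule summable_sums[OF summable_norm_cancel[OF dunkl_exp_abs_summable]])

lemma dunkl_exp_pos:
  assumes "\<mu> \<ge> 0" "y \<ge> 0"
  shows "dunkl_exp \<mu> y > 0"
  unfolding dunkl_exp_def
proof (rule suminf_pos2[where i = 0])
  show "summable (\<lambda>i. y ^ i / dunkl_gamma \<mu> i)"
    using dunkl_exp_sums[OF assms(1)] by (rule sums_summable)
qed (use assms dunkl_gamma_pos[OF assms(1)] in \<open>auto intro!: divide_nonneg_pos\<close>)

text \<open>The node is exactly the factor in the recurrence for \<open>dunkl_gamma\<close>, so
  multiplying by it cancels and shifts the index, as \<open>i / i! = 1 / (i - 1)!\<close> does for
  the ordinary exponential.\<close>

lemma dunkl_node_mult_Suc:
  assumes "\<mu> \<ge> 0"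
  shows "dunkl_node \<mu> (Suc i) * (y ^ Suc i / dunkl_gamma \<mu> (Suc i)) = y * (y ^ i / dunkl_gamma \<mu> i)"
proof -
  have "dunkl_node \<mu> (Suc i) > 0"
    using assms by (auto simp: dunkl_node_def dunkl_theta_def)
  then show ?thesis
    using dunkl_gamma_pos[OF assms, of i]
    by (simp add: dunkl_gamma_Suc[OF assms, folded dunkl_node_def])
qed

lemma dunkl_exp_first_moment:
  assumes "\<mu> \<ge> 0"
  shows "(\<lambda>i. dunkl_node \<mu> i * (y ^ i / dunkl_gamma \<mu> i)) sums (y * dunkl_exp \<mu> y)"
proof -
  have "(\<lambda>i. dunkl_node \<mu> (Suc i) * (y ^ Suc i / dunkl_gamma \<mu> (Suc i))) sums (y * dunkl_exp \<mu> y)"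
    unfolding dunkl_node_mult_Suc[OF assms] by (intro sums_mult dunkl_exp_sums assms)
  \<comment> \<open>The unshifted series has no extra term, since the node of index 0 is 0.\<close>
  then show ?thesis
    by (subst (asm) sums_Suc_iff) (simp add: dunkl_node_def dunkl_theta_def)
qed

text \<open>One factor of the square is absorbed by the index shift. The other becomes the node of
  \<open>Suc i\<close>, whose increment over the node of \<open>i\<close> is
  \<open>1 + 2 * \<mu>\<close> or \<open>1 - 2 * \<mu>\<close> depending on parity; bounding it by
  the larger value leads to an inequality.\<close>

lemma dunkl_exp_second_moment:
  assumes mu: "\<mu> \<ge> 0" and y: "y \<ge> 0"
  defines "p \<equiv> \<lambda>i. y ^ i / dunkl_gamma \<mu> i"
  shows "summable (\<lambda>i. (dunkl_node \<mu> i)\<^sup>2 * p i)"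
    and "(\<Sum>i. (dunkl_node \<mu> i)\<^sup>2 * p i) \<le> y * (y + (1 + 2 * \<mu>)) * dunkl_exp \<mu> y"
proof -
  let ?q = "\<lambda>i. y * ((dunkl_node \<mu> i + (1 + 2 * \<mu>)) * p i)"
  have p: "p i \<ge> 0" for i
    unfolding p_def using dunkl_gamma_pos[OF mu, of i] y by simp
  have Suc_eq: "(dunkl_node \<mu> (Suc i))\<^sup>2 * p (Suc i) = y * (dunkl_node \<mu> (Suc i) * p i)" for i
    using dunkl_node_mult_Suc[OF mu, of i y] unfolding p_def power2_eq_square mult.assoc
    by (simp add: mult.left_commute)
  have le: "(dunkl_node \<mu> (Suc i))\<^sup>2 * p (Suc i) \<le> ?q i" for i
    unfolding Suc_eq using dunkl_node_Suc_le[OF mu, of i] p y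
    by (intro mult_left_mono mult_right_mono) auto
  have q: "?q sums (y * (y * dunkl_exp \<mu> y + (1 + 2 * \<mu>) * dunkl_exp \<mu> y))"
    unfolding distrib_right p_def
    by (intro sums_mult sums_add dunkl_exp_first_moment dunkl_exp_sums mu)
  have summ: "summable (\<lambda>i. (dunkl_node \<mu> (Suc i))\<^sup>2 * p (Suc i))"
    by (rule summable_comparison_test'[OF sums_summable[OF q], of 0]) (use le p in auto)
  then show s: "summable (\<lambda>i. (dunkl_node \<mu> i)\<^sup>2 * p i)"
    by (subst (asm) summable_Suc_iff)
  have "(\<Sum>i. (dunkl_node \<mu> i)\<^sup>2 * p i) = (\<Sum>i. (dunkl_node \<mu> (Suc i))\<^sup>2 * p (Suc i))"
    using suminf_split_head[OF s] by (simp add: dunkl_node_def dunkl_theta_def)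
  also have "\<dots> \<le> y * (y * dunkl_exp \<mu> y + (1 + 2 * \<mu>) * dunkl_exp \<mu> y)"
    using suminf_le[OF le summ sums_summable[OF q]] sums_unique[OF q] by simp
  finally show "(\<Sum>i. (dunkl_node \<mu> i)\<^sup>2 * p i) \<le> y * (y + (1 + 2 * \<mu>)) * dunkl_exp \<mu> y"
    by (simp add: algebra_simps)
qed

text \<open>After expanding the square, the contributions of order \<open>y\<^sup>2\<close> cancel,
  leaving a bound linear in \<open>y\<close> relative to \<open>dunkl_exp \<mu> y\<close>. This gain
  makes the rescaled moment tend to 0.\<close>

lemma dunkl_exp_central_moment:
  assumes mu: "\<mu> \<ge> 0" and y: "y \<ge> 0"
  shows "summable (\<lambda>i. (dunkl_node \<mu> i - y)\<^sup>2 * (y ^ i / dunkl_gamma \<mu> i))" (is "summable ?s")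
    and "(\<Sum>i. (dunkl_node \<mu> i - y)\<^sup>2 * (y ^ i / dunkl_gamma \<mu> i)) \<le> (1 + 2 * \<mu>) * y * dunkl_exp \<mu> y"
proof -
  note second = dunkl_exp_second_moment[OF mu y]
  let ?p = "\<lambda>i. y ^ i / dunkl_gamma \<mu> i"
  have "(\<lambda>i. (dunkl_node \<mu> i)\<^sup>2 * ?p i - 2 * y * (dunkl_node \<mu> i * ?p i) + y\<^sup>2 * ?p i) sums
      ((\<Sum>i. (dunkl_node \<mu> i)\<^sup>2 * ?p i) - 2 * y * (y * dunkl_exp \<mu> y) + y\<^sup>2 * dunkl_exp \<mu> y)"
    by (intro sums_add sums_diff sums_mult dunkl_exp_sums dunkl_exp_first_moment mu
        summable_sums second)
  moreover have "(dunkl_node \<mu> i)\<^sup>2 * ?p i - 2 * y * (dunkl_node \<mu> i * ?p i) + y\<^sup>2 * ?p i =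
      (dunkl_node \<mu> i - y)\<^sup>2 * ?p i" for i
    by (simp only: power2_diff) (simp only: ring_distribs ac_simps)
  ultimately have s: "?s sums ((\<Sum>i. (dunkl_node \<mu> i)\<^sup>2 * ?p i) - 2 * y * (y * dunkl_exp \<mu> y)
      + y\<^sup>2 * dunkl_exp \<mu> y)"
    by simp
  then show "summable ?s" by (rule sums_summable)
  show "suminf ?s \<le> (1 + 2 * \<mu>) * y * dunkl_exp \<mu> y"
    using second(2) unfolding sums_unique[OF s, symmetric]
    by (simp add: power2_eq_square algebra_simps)
qed

section \<open>Summability of the coefficients of \<open>Q\<close> with quadratic weights\<close>

lemma eventually_quadratic_le_power:
  fixes r c :: real
  assumes "r > 1"
  shows "eventually (\<lambda>i. (real i + c)\<^sup>2 \<le> r ^ i) sequentially"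
proof -
  \<comment> \<open>With the square root as base, it suffices to compare a linear term with
    \<open>t ^ i\<close> and square at the end.\<close>
  define t where "t = sqrt r"
  have t: "t > 1" "r = t\<^sup>2" using assms by (auto simp: t_def)
  have "(\<lambda>i. real i / t ^ i + c / t ^ i) \<longlonglongrightarrow> 0 + 0"
  proof (intro tendsto_add)
    show "(\<lambda>i. real i / t ^ i) \<longlonglongrightarrow> 0"
      using lim_n_over_pown[of t] t by simp
    show "(\<lambda>i. c / t ^ i) \<longlonglongrightarrow> 0"
      by (rule LIMSEQ_divide_realpow_zero[OF t(1)])
  qed
  then have "eventually (\<lambda>i. dist (real i / t ^ i + c / t ^ i) 0 < 1) sequentially"
    by (intro tendstoD) auto
  then show ?thesis
  proof eventually_elim
    fix i assume "dist (real i / t ^ i + c / t ^ i) 0 < 1"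
    then have "\<bar>real i + c\<bar> / t ^ i < 1"
      using t(1) by (simp add: dist_real_def flip: add_divide_distrib)
    then have "\<bar>real i + c\<bar> \<le> t ^ i"
      using t(1) by (simp add: divide_less_eq)
    then have "\<bar>real i + c\<bar>\<^sup>2 \<le> (t ^ i)\<^sup>2"
      by (intro power_mono) auto
    then show "(real i + c)\<^sup>2 \<le> r ^ i"
      by (simp add: t(2) mult.commute flip: power_mult)
  qed
qed

text \<open>Convergence at \<open>s\<close> gives absolute convergence at any \<open>r\<close>
  strictly between 1 and \<open>s\<close>, and \<open>r ^ i\<close> eventually dominates the
  quadratic weight.\<close>

lemma powser_quadratic_weight_summable:
  fixes b :: "nat \<Rightarrow> real"
  assumes "summable (\<lambda>i. b i * s ^ i)" "s > 1"
  shows "summable (\<lambda>i. \<bar>b i\<bar> * (real i + c)\<^sup>2)"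
proof -
  obtain r where r: "1 < r" "r < s" using dense[OF assms(2)] by blast
  have "summable (\<lambda>i. norm (b i * r ^ i))"
    by (rule powser_insidea[OF assms(1)]) (use r in auto)
  moreover have "eventually (\<lambda>i. (real i + c)\<^sup>2 \<le> r ^ i) sequentially"
    using r(1) by (rule eventually_quadratic_le_power)
  then have "eventually (\<lambda>i. norm (\<bar>b i\<bar> * (real i + c)\<^sup>2) \<le> norm (b i * r ^ i)) sequentially"
    by eventually_elim (use r in \<open>simp add: abs_mult mult_left_mono\<close>)
  ultimately show ?thesis by (rule summable_comparison_test_ev[rotated])
qed

section \<open>Second central moment of the Appell weights\<close>

lemma dunkl_appell_eq:
  assumes "\<mu> \<ge> 0"
  shows "dunkl_appell \<mu> a k y / dunkl_gamma \<mu> k =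
    (\<Sum>i\<le>k. y ^ i / dunkl_gamma \<mu> i * (a (k - i) / dunkl_gamma \<mu> (k - i)))"
  unfolding dunkl_appell_def sum_divide_distrib using dunkl_gamma_pos[OF assms, of k]
  by (intro sum.cong) simp_all

text \<open>The weights are the Cauchy product of the exponential weights and the coefficients of
  \<open>Q\<close>. The shift estimate therefore bounds the moment by two Cauchy products: central
  moment times \<open>\<bar>b\<bar>\<close>, and total mass times \<open>B\<close>. Both carry a
  factor \<open>dunkl_exp \<mu> y\<close>, which the normalisation of the operator removes.\<close>

lemma dunkl_appell_central_moment:
  fixes a :: "nat \<Rightarrow> real"
  assumes mu: "\<mu> \<ge> 0" and y: "y \<ge> 0"
    and nonneg: "\<And>i. dunkl_appell \<mu> a i y \<ge> 0"
    and b: "summable (\<lambda>j. \<bar>a j / dunkl_gamma \<mu> j\<bar>)"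
    and b2: "summable (\<lambda>j. \<bar>a j / dunkl_gamma \<mu> j\<bar> * (dunkl_node \<mu> j + 4 * \<mu>)\<^sup>2)"
  defines "w \<equiv> \<lambda>k. dunkl_appell \<mu> a k y / dunkl_gamma \<mu> k"
  shows "summable (\<lambda>k. (dunkl_node \<mu> k - y)\<^sup>2 * w k)"
    and "(\<Sum>k. (dunkl_node \<mu> k - y)\<^sup>2 * w k) \<le>
      (2 * (1 + 2 * \<mu>) * y * (\<Sum>j. \<bar>a j / dunkl_gamma \<mu> j\<bar>) +
       2 * (\<Sum>j. \<bar>a j / dunkl_gamma \<mu> j\<bar> * (dunkl_node \<mu> j + 4 * \<mu>)\<^sup>2)) * dunkl_exp \<mu> y"
proof -
  define p where "p i = y ^ i / dunkl_gamma \<mu> i" for i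
  define b where "b j = a j / dunkl_gamma \<mu> j" for j
  define P where "P i = (dunkl_node \<mu> i - y)\<^sup>2 * p i" for i
  define B where "B j = \<bar>b j\<bar> * (dunkl_node \<mu> j + 4 * \<mu>)\<^sup>2" for j
  have p: "p i \<ge> 0" for i
    unfolding p_def using dunkl_gamma_pos[OF mu, of i] y by simp
  have pE: "p sums dunkl_exp \<mu> y"
    unfolding p_def by (rule dunkl_exp_sums[OF mu])
  have P: "summable P" "suminf P \<le> (1 + 2 * \<mu>) * y * dunkl_exp \<mu> y"
    unfolding P_def p_def by (rule dunkl_exp_central_moment[OF mu y])+
  have P_nonneg: "P i \<ge> 0" and B_nonneg: "B i \<ge> 0" for i
    unfolding P_def B_def using p by simp_all
  have sb: "summable (\<lambda>j. \<bar>b j\<bar>)" and sB: "summable B"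
    using b b2 unfolding b_def B_def by auto
  have sums1: "(\<lambda>k. \<Sum>i\<le>k. P i * \<bar>b (k - i)\<bar>) sums (suminf P * (\<Sum>j. \<bar>b j\<bar>))"
    by (rule Cauchy_product_sums) (use P(1) P_nonneg sb in simp_all)
  have sums2: "(\<lambda>k. \<Sum>i\<le>k. p i * B (k - i)) sums (suminf p * suminf B)"
    by (rule Cauchy_product_sums) (use sums_summable[OF pE] p sB B_nonneg in simp_all)
  let ?M = "\<lambda>k. 2 * (\<Sum>i\<le>k. P i * \<bar>b (k - i)\<bar>) + 2 * (\<Sum>i\<le>k. p i * B (k - i))"
  have M: "?M sums (2 * (suminf P * (\<Sum>j. \<bar>b j\<bar>)) + 2 * (suminf p * suminf B))"
    by (intro sums_add sums_mult sums1 sums2)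
  have w: "w k \<ge> 0" for k
    unfolding w_def using nonneg[of k] dunkl_gamma_pos[OF mu, of k] by simp
  have le: "(dunkl_node \<mu> k - y)\<^sup>2 * w k \<le> ?M k" for k
  proof -
    have "(dunkl_node \<mu> k - y)\<^sup>2 * w k = (\<Sum>i\<le>k. (dunkl_node \<mu> k - y)\<^sup>2 * (p i * b (k - i)))"
      unfolding w_def dunkl_appell_eq[OF mu] p_def b_def by (rule sum_distrib_left)
    also have "\<dots> \<le> (\<Sum>i\<le>k. 2 * (P i * \<bar>b (k - i)\<bar>) + 2 * (p i * B (k - i)))"
    proof (rule sum_mono)
      fix i assume "i \<in> {..k}"
      then have k: "k = i + (k - i)" by simp
      \<comment> \<open>Single coefficients \<open>b\<close> may be negative even though the
        \<open>w k\<close> are not, so absolute values are taken termwise.\<close>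
      have "(dunkl_node \<mu> k - y)\<^sup>2 * (p i * b (k - i)) \<le> (dunkl_node \<mu> k - y)\<^sup>2 * (p i * \<bar>b (k - i)\<bar>)"
        using p by (intro mult_left_mono) auto
      also have "\<dots> \<le> (2 * (dunkl_node \<mu> i - y)\<^sup>2 + 2 * (dunkl_node \<mu> (k - i) + 4 * \<mu>)\<^sup>2) *
          (p i * \<bar>b (k - i)\<bar>)"
        using dunkl_node_shift_le[OF mu, of i "k - i" y] p k by (intro mult_right_mono) auto
      also have "\<dots> = 2 * (P i * \<bar>b (k - i)\<bar>) + 2 * (p i * B (k - i))"
        unfolding P_def B_def by (simp only: ring_distribs ac_simps)
      finally show "(dunkl_node \<mu> k - y)\<^sup>2 * (p i * b (k - i)) \<le> \<dots>" .
    qed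
    also have "\<dots> = ?M k" by (simp add: sum.distrib sum_distrib_left)
    finally show ?thesis .
  qed
  \<comment> \<open>Since \<open>w k\<close> is nonnegative, the one-sided bound \<open>le\<close>
    also bounds the norm.\<close>
  show s: "summable (\<lambda>k. (dunkl_node \<mu> k - y)\<^sup>2 * w k)"
    by (rule summable_comparison_test'[OF sums_summable[OF M], of 0]) (use le w in auto)
  have "(\<Sum>k. (dunkl_node \<mu> k - y)\<^sup>2 * w k) \<le>
      2 * (suminf P * (\<Sum>j. \<bar>b j\<bar>)) + 2 * (suminf p * suminf B)"
    using suminf_le[OF le s sums_summable[OF M]] sums_unique[OF M] by simp
  also have "\<dots> \<le> 2 * ((1 + 2 * \<mu>) * y * dunkl_exp \<mu> y * (\<Sum>j. \<bar>b j\<bar>)) +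
      2 * (dunkl_exp \<mu> y * suminf B)"
    using P(2) suminf_nonneg[OF sb] sums_unique[OF pE] by (simp add: mult_right_mono)
  also have "\<dots> = (2 * (1 + 2 * \<mu>) * y * (\<Sum>j. \<bar>b j\<bar>) + 2 * suminf B) * dunkl_exp \<mu> y"
    by (simp only: ring_distribs ac_simps)
  finally show "(\<Sum>k. (dunkl_node \<mu> k - y)\<^sup>2 * w k) \<le>
      (2 * (1 + 2 * \<mu>) * y * (\<Sum>j. \<bar>a j / dunkl_gamma \<mu> j\<bar>) +
       2 * (\<Sum>j. \<bar>a j / dunkl_gamma \<mu> j\<bar> * (dunkl_node \<mu> j + 4 * \<mu>)\<^sup>2)) * dunkl_exp \<mu> y"
    unfolding b_def B_def .
qed

section \<open>Growth and continuity of \<open>f\<close>\<close>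

lemma quadratic_growth_bound:
  fixes f :: "real \<Rightarrow> real"
  assumes cont: "continuous_on {0..} f" and lim: "((\<lambda>x. f x / (1 + x\<^sup>2)) \<longlongrightarrow> A) at_top"
  obtains D where "D > 0" "\<And>u. u \<ge> 0 \<Longrightarrow> \<bar>f u\<bar> \<le> D * (1 + u\<^sup>2)"
proof -
  have "eventually (\<lambda>x. dist (f x / (1 + x\<^sup>2)) A < 1) at_top"
    using lim by (rule tendstoD) simp
  then obtain N where N: "\<And>x. x \<ge> N \<Longrightarrow> dist (f x / (1 + x\<^sup>2)) A < 1"
    unfolding eventually_at_top_linorder by blast
  have "compact (f ` {0..N})"
    by (intro compact_continuous_image continuous_on_subset[OF cont]) auto
  then obtain M where M: "M > 0" "\<And>u. u \<in> {0..N} \<Longrightarrow> \<bar>f u\<bar> \<le> M"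
    using compact_imp_bounded bounded_pos by (metis imageI real_norm_def)
  show thesis
  proof
    show "M + \<bar>A\<bar> + 1 > 0" using M by simp
    fix u :: real assume u: "u \<ge> 0"
    have pos: "1 + u\<^sup>2 \<ge> 1" "1 + u\<^sup>2 > 0"
      using zero_le_power2[of u] by linarith+
    show "\<bar>f u\<bar> \<le> (M + \<bar>A\<bar> + 1) * (1 + u\<^sup>2)"
    proof (cases "u \<le> N")
      case True
      then have "\<bar>f u\<bar> \<le> M * 1" using M u by auto
      also have "\<dots> \<le> (M + \<bar>A\<bar> + 1) * (1 + u\<^sup>2)"
        using M pos by (intro mult_mono) auto
      finally show ?thesis .
    next
      case False
      then have "\<bar>f u / (1 + u\<^sup>2)\<bar> \<le> M + \<bar>A\<bar> + 1"
        using N[of u] M by (auto simp: dist_real_def)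
      then show ?thesis using pos(2) by (simp add: pos_divide_le_eq)
    qed
  qed
qed

text \<open>For \<open>u\<close> near \<open>x\<close>, uniform continuity gives
  \<open>\<epsilon>\<close>. Away from \<open>x\<close>, \<open>(u - x)\<^sup>2\<close> is at least
  \<open>\<delta>\<^sup>2\<close>, so a multiple of it absorbs the constants, and the quadratic
  growth of \<open>f\<close> is also controlled by it.\<close>

lemma korovkin_modulus_bound:
  fixes f :: "real \<Rightarrow> real"
  assumes cont: "continuous_on {0..} f" and lim: "((\<lambda>x. f x / (1 + x\<^sup>2)) \<longlongrightarrow> A) at_top"
    and eps: "\<epsilon> > 0"
  obtains C where "C \<ge> 0"
    "\<And>x u. x \<in> {0..\<beta>} \<Longrightarrow> u \<ge> 0 \<Longrightarrow> \<bar>f u - f x\<bar> \<le> \<epsilon> + C * (u - x)\<^sup>2"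
proof -
  obtain D where D: "D > 0" "\<And>u. u \<ge> 0 \<Longrightarrow> \<bar>f u\<bar> \<le> D * (1 + u\<^sup>2)"
    using quadratic_growth_bound[OF cont lim] by blast
  have "uniformly_continuous_on {0..\<beta> + 1} f"
    by (intro compact_uniformly_continuous continuous_on_subset[OF cont]) auto
  then obtain d where d: "d > 0"
    "\<And>x u. x \<in> {0..\<beta> + 1} \<Longrightarrow> u \<in> {0..\<beta> + 1} \<Longrightarrow> dist u x < d \<Longrightarrow> dist (f u) (f x) < \<epsilon>"
    using eps unfolding uniformly_continuous_on_def by metis
  \<comment> \<open>The cap 1 keeps every \<open>u\<close> within \<open>\<delta>\<close> of a point
    of \<open>{0..\<beta>}\<close> inside the larger interval
    \<open>{0..\<beta> + 1}\<close>.\<close>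
  define \<delta> where "\<delta> = min d 1"
  have \<delta>: "\<delta> > 0" using d by (simp add: \<delta>_def)
  define K where "K = D * (2 + 3 * \<beta>\<^sup>2)"
  have K: "K \<ge> 0" using D by (simp add: K_def)
  show thesis
  proof
    show "K / \<delta>\<^sup>2 + 2 * D \<ge> 0" using K D by simp
    fix x u :: real assume x: "x \<in> {0..\<beta>}" and u: "u \<ge> 0"
    show "\<bar>f u - f x\<bar> \<le> \<epsilon> + (K / \<delta>\<^sup>2 + 2 * D) * (u - x)\<^sup>2"
    proof (cases "\<bar>u - x\<bar> < \<delta>")
      case True
      then have "dist (f u) (f x) < \<epsilon>"
        using x u by (intro d(2)) (auto simp: \<delta>_def dist_real_def)
      moreover have "(K / \<delta>\<^sup>2 + 2 * D) * (u - x)\<^sup>2 \<ge> 0" using K D by simp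
      ultimately show ?thesis by (simp add: dist_real_def)
    next
      case False
      then have "\<delta>\<^sup>2 \<le> (u - x)\<^sup>2"
        using \<delta> by (metis less_eq_real_def not_le_imp_less power2_abs power_mono)
      then have "K \<le> K / \<delta>\<^sup>2 * (u - x)\<^sup>2"
        using K \<delta> by (simp add: pos_le_divide_eq mult_left_mono)
      moreover have "\<bar>f u - f x\<bar> \<le> D * (2 + u\<^sup>2 + x\<^sup>2)"
        using D(2)[of u] D(2)[of x] x u by (simp add: algebra_simps)
      \<comment> \<open>The difference of the two sides is \<open>(u - 2 * x)\<^sup>2\<close>.
        Together with \<open>x \<le> \<beta>\<close> this produces the coefficient 3 in
        \<open>K\<close>.\<close>
      moreover have "u\<^sup>2 \<le> 2 * x\<^sup>2 + 2 * (u - x)\<^sup>2"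
        using zero_le_power2[of "u - 2 * x"] by (simp add: power2_eq_square algebra_simps)
      moreover have "x\<^sup>2 \<le> \<beta>\<^sup>2" using x by (intro power_mono) auto
      ultimately have "\<bar>f u - f x\<bar> \<le> D * (2 + 3 * \<beta>\<^sup>2 + 2 * (u - x)\<^sup>2)"
        using D(1) by (elim order_trans) (intro mult_left_mono; simp)
      also have "\<dots> = K + 2 * D * (u - x)\<^sup>2" by (simp add: K_def algebra_simps)
      also have "\<dots> \<le> \<epsilon> + (K / \<delta>\<^sup>2 + 2 * D) * (u - x)\<^sup>2"
        using \<open>K \<le> K / \<delta>\<^sup>2 * (u - x)\<^sup>2\<close> eps by (simp add: algebra_simps)
      finally show ?thesis .
    qed
  qed
qed

section \<open>Averages with nonnegative weights\<close>

lemma normalised_series_close: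
  fixes w v g :: "nat \<Rightarrow> real"
  assumes w: "w sums W" "W > 0" and g: "\<And>k. \<bar>g k - c\<bar> \<le> \<epsilon> + v k" and pos: "\<And>k. w k \<ge> 0"
    and v: "summable (\<lambda>k. v k * w k)"
  shows "\<bar>1 / W * (\<Sum>k. w k * g k) - c\<bar> \<le> \<epsilon> + (\<Sum>k. v k * w k) / W"
proof -
  have M: "(\<lambda>k. \<epsilon> * w k + v k * w k) sums (\<epsilon> * W + (\<Sum>k. v k * w k))"
    by (intro sums_add sums_mult w summable_sums v)
  have le: "norm (w k * (g k - c)) \<le> \<epsilon> * w k + v k * w k" for k
  proof -
    have "norm (w k * (g k - c)) = w k * \<bar>g k - c\<bar>" using pos by (simp add: abs_mult)
    also have "\<dots> \<le> w k * (\<epsilon> + v k)" by (rule mult_left_mono[OF g pos])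
    finally show ?thesis by (simp add: algebra_simps)
  qed
  \<comment> \<open>Convergence is proved first for the centred series; adding the convergent series
    \<open>c * w k\<close> then gives the value of the original one.\<close>
  have s: "summable (\<lambda>k. w k * (g k - c))"
    by (rule summable_comparison_test'[OF sums_summable[OF M], of 0]) (rule le)
  have bound: "\<bar>\<Sum>k. w k * (g k - c)\<bar> \<le> \<epsilon> * W + (\<Sum>k. v k * w k)"
    using norm_suminf_le[OF le sums_summable[OF M]] sums_unique[OF M] by simp
  have "(\<lambda>k. w k * (g k - c) + c * w k) sums ((\<Sum>k. w k * (g k - c)) + c * W)"
    by (intro sums_add sums_mult w summable_sums s)
  then have "(\<Sum>k. w k * g k) = (\<Sum>k. w k * (g k - c)) + c * W"
    by (auto simp: algebra_simps dest: sums_unique)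
  then have "1 / W * (\<Sum>k. w k * g k) - c = (\<Sum>k. w k * (g k - c)) / W"
    using w(2) by (simp add: field_simps)
  also have "\<bar>\<dots>\<bar> \<le> (\<epsilon> * W + (\<Sum>k. v k * w k)) / W"
    using bound w(2) by (simp add: divide_right_mono)
  also have "\<dots> = \<epsilon> + (\<Sum>k. v k * w k) / W" using w(2) by (simp add: field_simps)
  finally show ?thesis .
qed

section \<open>Uniform convergence on compact intervals\<close>

theorem theorem1:
  fixes \<mu> R A :: real and a :: "nat \<Rightarrow> real" and f :: "real \<Rightarrow> real"
  assumes "\<mu> \<ge> 0"
    and "a 0 \<noteq> 0"
    and "R > 1"
    and "\<forall>z::complex. norm z < R \<longrightarrow> summable (\<lambda>i. of_real (a i / dunkl_gamma \<mu> i) * z ^ i)"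
    and "(dunkl_Q \<mu> a :: complex \<Rightarrow> complex) analytic_on ball 0 R"
    and "dunkl_Q \<mu> a (1::real) \<noteq> 0"
    and "\<forall>i. \<forall>x\<ge>0. dunkl_appell \<mu> a i x \<ge> 0"
    and "continuous_on {0..} f"
    and "((\<lambda>x. f x / (1 + x\<^sup>2)) \<longlongrightarrow> A) at_top"
  shows "\<forall>\<alpha> \<beta>. 0 \<le> \<alpha> \<and> \<alpha> < \<beta> \<longrightarrow>
           uniform_limit {\<alpha>..\<beta>} (\<lambda>n. dunkl_op \<mu> a n f) f sequentially"
proof (intro allI impI, elim conjE)
  fix \<alpha> \<beta> :: real assume \<alpha>: "0 \<le> \<alpha>" and \<alpha>\<beta>: "\<alpha> < \<beta>"
  note mu = assms(1) and nonneg = assms(7)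
  define Q where "Q = dunkl_Q \<mu> a (1::real)"
  define b where "b j = a j / dunkl_gamma \<mu> j" for j
  \<comment> \<open>\<open>R > 1\<close> leaves room for a real point beyond 1 at which the series
    of \<open>Q\<close> converges; this provides the decay of the coefficients.\<close>
  obtain s where s: "1 < s" "s < R" using dense[OF assms(3)] by blast
  have "summable (\<lambda>i. complex_of_real (b i) * complex_of_real s ^ i)"
    using assms(4) s unfolding b_def by auto
  then have "summable (\<lambda>i. complex_of_real (b i * s ^ i))" by simp
  then have bs: "summable (\<lambda>i. b i * s ^ i)" by (simp only: summable_complex_of_real)
  have sb: "summable (\<lambda>j. \<bar>b j\<bar>)"
    using powser_insidea[OF bs, of 1] s by simp
  have sB: "summable (\<lambda>j. \<bar>b j\<bar> * (dunkl_node \<mu> j + 4 * \<mu>)\<^sup>2)"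
  proof (rule summable_comparison_test'[of _ 0])
    show "summable (\<lambda>i. \<bar>b i\<bar> * (real i + 6 * \<mu>)\<^sup>2)"
      by (rule powser_quadratic_weight_summable[OF bs s(1)])
    fix j :: nat
    \<comment> \<open>The constant 6 is 2 from the node bound plus 4 from the shift
      estimate.\<close>
    have "(dunkl_node \<mu> j + 4 * \<mu>)\<^sup>2 \<le> (real j + 6 * \<mu>)\<^sup>2"
      using dunkl_node_le[OF mu, of j] dunkl_node_nonneg[OF mu, of j] mu
      by (intro power_mono) auto
    then show "norm (\<bar>b j\<bar> * (dunkl_node \<mu> j + 4 * \<mu>)\<^sup>2) \<le> \<bar>b j\<bar> * (real j + 6 * \<mu>)\<^sup>2"
      by (simp add: mult_left_mono)
  qed
  define w where "w y k = dunkl_appell \<mu> a k y / dunkl_gamma \<mu> k" for y k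
  have w: "w y k \<ge> 0" if "y \<ge> 0" for y k
    unfolding w_def using nonneg that dunkl_gamma_pos[OF mu, of k] by simp
  have w_sums: "w y sums (Q * dunkl_exp \<mu> y)" for y
    using dunkl_appell_generating[OF mu assms(4), of 1 y] assms(3) by (simp add: w_def[abs_def] Q_def)
  \<comment> \<open>The sign of \<open>Q(1)\<close> follows from positivity: at \<open>y = 0\<close>
    nonnegative weights sum to \<open>Q\<close> times a positive number.\<close>
  have "Q * dunkl_exp \<mu> 0 \<ge> 0"
    using sums_le[OF w sums_zero w_sums, of 0] by simp
  then have Q: "Q > 0"
    using dunkl_exp_pos[OF mu, of 0] assms(6) by (simp add: Q_def zero_le_mult_iff)
  define B0 where "B0 = (\<Sum>j. \<bar>b j\<bar>)"
  define B2 where "B2 = (\<Sum>j. \<bar>b j\<bar> * (dunkl_node \<mu> j + 4 * \<mu>)\<^sup>2)"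
  have B0: "B0 \<ge> 0" unfolding B0_def by (intro suminf_nonneg sb) simp
  \<comment> \<open>Bound for the second central moment of the operator, uniform for
    \<open>x\<close> up to \<open>\<beta>\<close>: the Appell moment bound with \<open>y\<close>
    replaced by \<open>n * \<beta>\<close>, divided by \<open>Q\<close> and by
    \<open>n\<^sup>2\<close> from rescaling the nodes.\<close>
  define V where "V n = (2 * (1 + 2 * \<mu>) * (real n * \<beta>) * B0 + 2 * B2) / (Q * (real n)\<^sup>2)" for n
  have "(\<lambda>n. 2 * (1 + 2 * \<mu>) * \<beta> * B0 / Q * inverse (real n) + 2 * B2 / Q * (inverse (real n))\<^sup>2) \<longlonglongrightarrow>
      2 * (1 + 2 * \<mu>) * \<beta> * B0 / Q * 0 + 2 * B2 / Q * 0\<^sup>2"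
    by (intro tendsto_intros lim_inverse_n)
  \<comment> \<open>At \<open>n = 0\<close> both sides are 0 because division by zero yields
    0.\<close>
  moreover have "2 * (1 + 2 * \<mu>) * \<beta> * B0 / Q * inverse (real n) + 2 * B2 / Q * (inverse (real n))\<^sup>2 = V n" for n
    using Q by (cases "n = 0") (simp_all add: V_def field_simps power2_eq_square)
  ultimately have V: "V \<longlonglongrightarrow> 0" by simp
  show "uniform_limit {\<alpha>..\<beta>} (\<lambda>n. dunkl_op \<mu> a n f) f sequentially"
  proof (rule uniform_limitI)
    fix e :: real assume e: "e > 0"
    obtain C where C: "C \<ge> 0"
      "\<And>x u. x \<in> {0..\<beta>} \<Longrightarrow> u \<ge> 0 \<Longrightarrow> \<bar>f u - f x\<bar> \<le> e / 2 + C * (u - x)\<^sup>2"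
      using korovkin_modulus_bound[OF assms(8,9), of "e / 2" \<beta>] e by auto
    have "(\<lambda>n. C * V n) \<longlonglongrightarrow> C * 0" by (intro tendsto_intros V)
    then have "eventually (\<lambda>n. C * V n < e / 2) sequentially"
      using e by (intro order_tendstoD(2)) auto
    then show "\<forall>\<^sub>F n in sequentially. \<forall>x\<in>{\<alpha>..\<beta>}. dist (dunkl_op \<mu> a n f x) (f x) < e"
      using eventually_gt_at_top[of 0]
    proof eventually_elim
      fix n :: nat assume small: "C * V n < e / 2" and n: "0 < n"
      show "\<forall>x\<in>{\<alpha>..\<beta>}. dist (dunkl_op \<mu> a n f x) (f x) < e"
      proof
        fix x assume "x \<in> {\<alpha>..\<beta>}"
        then have x: "x \<in> {0..\<beta>}" using \<alpha> by auto
        define y where "y = real n * x"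
        define E where "E = dunkl_exp \<mu> y"
        have y: "y \<ge> 0" "y \<le> real n * \<beta>" using x by (auto simp: y_def mult_left_mono)
        have E: "E > 0" unfolding E_def by (rule dunkl_exp_pos[OF mu y(1)])
        have QE: "Q * E > 0" using Q E by simp
        let ?m = "\<lambda>k. (dunkl_node \<mu> k - y)\<^sup>2 * w y k"
        have m: "summable ?m" "suminf ?m \<le> (2 * (1 + 2 * \<mu>) * y * B0 + 2 * B2) * E"
          using dunkl_appell_central_moment[OF mu y(1) nonneg[rule_format, OF y(1)]] sb sB
          unfolding b_def w_def B0_def B2_def E_def by blast+
        let ?v = "\<lambda>k. C * (dunkl_node \<mu> k / real n - x)\<^sup>2"
        \<comment> \<open>With \<open>y = n * x\<close>, the deviation of the sample point from
          \<open>x\<close> is that of the node from \<open>y\<close>, divided by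
          \<open>n\<close>.\<close>
        have v: "?v k * w y k = C / (real n)\<^sup>2 * ?m k" for k
          using n by (simp add: y_def field_simps power2_eq_square)
        have "\<bar>1 / (Q * E) * (\<Sum>k. w y k * f (dunkl_node \<mu> k / real n)) - f x\<bar> \<le>
            e / 2 + (\<Sum>k. ?v k * w y k) / (Q * E)"
        proof (rule normalised_series_close)
          show "w y sums (Q * E)" unfolding E_def by (rule w_sums)
          show "summable (\<lambda>k. ?v k * w y k)" unfolding v by (intro summable_mult m)
        qed (use QE w y C(2)[OF x] dunkl_node_nonneg[OF mu] in auto)
        also have "(\<Sum>k. ?v k * w y k) = C / (real n)\<^sup>2 * suminf ?m"
          unfolding v by (rule suminf_mult[OF m(1)])
        also have "\<dots> / (Q * E) \<le> C / (real n)\<^sup>2 * ((2 * (1 + 2 * \<mu>) * (real n * \<beta>) * B0 + 2 * B2) * E) / (Q * E)"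
        proof (intro divide_right_mono mult_left_mono order_trans[OF m(2)] mult_right_mono add_right_mono)
        qed (use y mu B0 C QE E in auto)
        \<comment> \<open>The exponential factor cancels, leaving a bound that no longer depends on
          \<open>x\<close>.\<close>
        also have "\<dots> = C * V n" using E Q n by (simp add: V_def field_simps)
        finally show "dist (dunkl_op \<mu> a n f x) (f x) < e"
          using small by (simp add: dist_real_def dunkl_op_def Q_def E_def w_def y_def dunkl_node_def)
      qed
    qed
  qed
qed

end
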